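(* Let $n,k\ge 1$ be two positive integers. Then $ex^{lin}_4(n,P_k)\le 2.5\,kn$.
   Context: A quadruple system (4-uniform hypergraph) consists of a finite vertex set and a set of 4-element subsets of it, called edges or quadruples. It is linear if every pair of vertices is contained in at most one edge. It is $F$-free if it contains no subhypergraph isomorphic to $F$ (not necessarily induced). $ex^{lin}_4(n,F)$ is the maximum number of edges in an $F$-free linear quadruple system on $n$ vertices. The linear 4-path $P_k$ has $k$ quadruples $e_i=\{x_{3i-2},x_{3i-1},x_{3i},x_{3i+1}\}$, $1\le i\le k$, where $x_1,\dots,x_{3k+1}$ are distinct vertices. *)

theory Defs
  imports Complex_Main
begin

text \<open>A hypergraph is a pair of a vertex set and an edge set.\<close>

type_synonym 'a hypergraph = "'a set \<times> 'a set set"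

abbreviation verts :: "'a hypergraph \<Rightarrow> 'a set" where "verts \<equiv> fst"
abbreviation edges :: "'a hypergraph \<Rightarrow> 'a set set" where "edges \<equiv> snd"

definition quadruple_system :: "'a hypergraph \<Rightarrow> bool" where
  "quadruple_system H \<longleftrightarrow>
     finite (verts H) \<and> (\<forall>e\<in>edges H. e \<subseteq> verts H \<and> card e = 4)"

definition linear_hypergraph :: "'a hypergraph \<Rightarrow> bool" where
  "linear_hypergraph H \<longleftrightarrow>
     (\<forall>x\<in>verts H. \<forall>y\<in>verts H. x \<noteq> y \<longrightarrow>
        (\<forall>e\<in>edges H. \<forall>e'\<in>edges H. {x, y} \<subseteq> e \<longrightarrow> {x, y} \<subseteq> e' \<longrightarrow> e = e'))"

definition subhypergraph :: "'a hypergraph \<Rightarrow> 'a hypergraph \<Rightarrow> bool" where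
  "subhypergraph K H \<longleftrightarrow>
     verts K \<subseteq> verts H \<and> edges K \<subseteq> edges H \<and> (\<forall>e\<in>edges K. e \<subseteq> verts K)"

definition isomorphic :: "'a hypergraph \<Rightarrow> 'b hypergraph \<Rightarrow> bool" where
  "isomorphic F K \<longleftrightarrow>
     (\<exists>f. bij_betw f (verts F) (verts K) \<and> edges K = (\<lambda>e. f ` e) ` edges F)"

definition is_free :: "'b hypergraph \<Rightarrow> 'a hypergraph \<Rightarrow> bool" where
  "is_free F H \<longleftrightarrow> (\<nexists>K. subhypergraph K H \<and> isomorphic F K)"

text \<open>
  The competing systems have their vertices in \<^typ>\<open>nat\<close>; by \<open>card_edges_le_ex_lin4\<close> below
  this is no restriction. \<open>Max\<close> is a genuine maximum as soon as \<open>F\<close> has an edge, see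
  \<open>finite_edge_counts\<close> and \<open>edge_counts_nonempty\<close>.
\<close>

definition edge_counts :: "nat \<Rightarrow> 'b hypergraph \<Rightarrow> nat set" where
  "edge_counts n F =
     {card (edges H) | H :: nat hypergraph.
        quadruple_system H \<and> linear_hypergraph H \<and> card (verts H) = n \<and> is_free F H}"

definition ex_lin4 :: "nat \<Rightarrow> 'b hypergraph \<Rightarrow> nat" where
  "ex_lin4 n F = Max (edge_counts n F)"

text \<open>The vertex \<open>x\<^sub>j\<close> of the path is the number \<open>j\<close>.\<close>

definition linear_path4 :: "nat \<Rightarrow> nat hypergraph" where
  "linear_path4 k =
     ({1..3 * k + 1}, (\<lambda>i. {3 * i - 2, 3 * i - 1, 3 * i, 3 * i + 1}) ` {1..k})"

lemma quadruple_system_linear_path4: "quadruple_system (linear_path4 k)"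
  by (auto simp: quadruple_system_def linear_path4_def card_insert_if)

lemma card_edges_linear_path4: "card (edges (linear_path4 k)) = k"
proof -
  have "inj_on (\<lambda>i::nat. {3 * i - 2, 3 * i - 1, 3 * i, 3 * i + 1}) {1..k}"
  proof (rule inj_onI)
    fix i j :: nat
    assume ij: "i \<in> {1..k}" "j \<in> {1..k}"
      and eq: "{3 * i - 2, 3 * i - 1, 3 * i, 3 * i + 1} = {3 * j - 2, 3 * j - 1, 3 * j, 3 * j + 1}"
    have "3 * i + 1 \<in> {3 * j - 2, 3 * j - 1, 3 * j, 3 * j + 1}" using eq by blast
    moreover have "3 * j + 1 \<in> {3 * i - 2, 3 * i - 1, 3 * i, 3 * i + 1}" using eq by blast
    ultimately show "i = j" using ij by auto
  qed
  then show ?thesis by (simp add: linear_path4_def card_image)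
qed

lemma finite_edge_counts: "finite (edge_counts n F)"
proof -
  have "m \<le> 2 ^ n" if "m \<in> edge_counts n F" for m
  proof -
    from that obtain H :: "nat hypergraph"
      where H: "quadruple_system H" "card (verts H) = n" "m = card (edges H)"
      by (auto simp: edge_counts_def)
    then have "finite (verts H)" "edges H \<subseteq> Pow (verts H)"
      by (auto simp: quadruple_system_def)
    then have "card (edges H) \<le> card (Pow (verts H))"
      by (intro card_mono) auto
    with H \<open>finite (verts H)\<close> show ?thesis by (simp add: card_Pow)
  qed
  then have "edge_counts n F \<subseteq> {..2 ^ n}" by auto
  then show ?thesis by (rule finite_subset) simp
qed

lemma edge_counts_nonempty:
  assumes "edges F \<noteq> {}"
  shows "edge_counts n F \<noteq> {}"
proof -
  let ?H = "({..<n}, {}) :: nat hypergraph"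
  have "is_free F ?H"
    using assms by (auto simp: is_free_def subhypergraph_def isomorphic_def)
  then have "card (edges ?H) \<in> edge_counts n F"
    unfolding edge_counts_def
    by (intro CollectI exI[of _ ?H]) (auto simp: quadruple_system_def linear_hypergraph_def)
  then show ?thesis by auto
qed

lemma card_edges_le_ex_lin4:
  fixes H :: "'a hypergraph"
  assumes q: "quadruple_system H" and lin: "linear_hypergraph H"
    and card: "card (verts H) = n" and free: "is_free F H"
  shows "card (edges H) \<le> ex_lin4 n F"
proof -
  have fin: "finite (verts H)" and sub: "\<And>e. e \<in> edges H \<Longrightarrow> e \<subseteq> verts H"
    and four: "\<And>e. e \<in> edges H \<Longrightarrow> card e = 4"
    using q by (auto simp: quadruple_system_def)
  obtain g :: "'a \<Rightarrow> nat" where g: "inj_on g (verts H)"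
    using fin finite_imp_inj_to_nat_seg by metis
  define h where "h = inv_into (verts H) g"
  have hg: "h (g x) = x" if "x \<in> verts H" for x using g that by (simp add: h_def)
  have hge: "h ` g ` e = e" if "e \<subseteq> verts H" for e
    using that hg by (force simp: image_image)
  define H' where "H' = (g ` verts H, (\<lambda>e. g ` e) ` edges H)"
  have V': "verts H' = g ` verts H" and E': "edges H' = (\<lambda>e. g ` e) ` edges H"
    by (simp_all add: H'_def)
  have "quadruple_system H'"
    unfolding quadruple_system_def V' E'
    using fin sub four by (auto simp: card_image[OF inj_on_subset[OF g]])
  moreover have "linear_hypergraph H'"
    unfolding linear_hypergraph_def V' E'
  proof clarify
    fix x y e e'
    assume *: "x \<in> verts H" "y \<in> verts H" "g x \<noteq> g y" "e \<in> edges H" "e' \<in> edges H"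
      "{g x, g y} \<subseteq> g ` e" "{g x, g y} \<subseteq> g ` e'"
    have "{x, y} \<subseteq> e" "{x, y} \<subseteq> e'"
      using * sub g by (auto simp: inj_on_image_mem_iff)
    moreover have "x \<noteq> y" using * by auto
    ultimately have "e = e'" using lin * unfolding linear_hypergraph_def by blast
    then show "g ` e = g ` e'" by simp
  qed
  moreover have "card (verts H') = n" using card g by (simp add: V' card_image)
  moreover have "is_free F H'"
    unfolding is_free_def
  proof clarify
    fix W D assume s: "subhypergraph (W, D) H'" and i: "isomorphic F (W, D)"
    then obtain f where f: "bij_betw f (verts F) W" "D = (\<lambda>e. f ` e) ` edges F"
      by (auto simp: isomorphic_def)
    have W: "W \<subseteq> g ` verts H" and D: "D \<subseteq> (\<lambda>e. g ` e) ` edges H"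
      and DW: "\<And>d. d \<in> D \<Longrightarrow> d \<subseteq> W"
      using s by (auto simp: subhypergraph_def V' E')
    let ?K = "(h ` W, (\<lambda>e. h ` e) ` D)"
    have "subhypergraph ?K H"
    proof -
      have "h ` W \<subseteq> verts H" using W hg by auto
      moreover have "h ` d \<in> edges H" if d: "d \<in> D" for d
      proof -
        obtain e where "e \<in> edges H" "d = g ` e" using D d by blast
        then show ?thesis using hge[OF sub] by simp
      qed
      moreover have "h ` d \<subseteq> h ` W" if "d \<in> D" for d using DW[OF that] by blast
      ultimately show ?thesis by (auto simp: subhypergraph_def)
    qed
    moreover have "isomorphic F ?K"
    proof -
      have "inj_on h W" using W by (auto simp: h_def intro: inj_on_inv_into)
      then have "bij_betw (h \<circ> f) (verts F) (h ` W)"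
        using f(1) by (auto intro: bij_betw_trans inj_on_imp_bij_betw)
      then show ?thesis
        unfolding isomorphic_def using f(2)
        by (intro exI[of _ "h \<circ> f"]) (auto simp: image_comp)
    qed
    ultimately show False using free by (auto simp: is_free_def)
  qed
  ultimately have "card (edges H') \<in> edge_counts n F"
    unfolding edge_counts_def by blast
  then have "card (edges H') \<le> ex_lin4 n F"
    unfolding ex_lin4_def by (rule Max_ge[OF finite_edge_counts])
  moreover have "inj_on (\<lambda>e. g ` e) (edges H)"
    using hge sub by (metis inj_onI)
  then have "card (edges H') = card (edges H)" by (simp add: E' card_image)
  ultimately show ?thesis by simp
qed

end

theory Submission
  imports Defs
begin

text \<open>
  The proof is an Erdos-Gallai argument for linear quadruple systems. Let \<open>E\<close> be an edge set with
  no path of \<open>k\<close> edges. It suffices to find a nonempty vertex set \<open>X\<close> that meets at most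
  \<open>5 k |X| / 2\<close> edges: delete these edges and use induction (\<open>card_edges_le_if_no_loose_path\<close>).
  Suppose that there is no such \<open>X\<close>; in particular all degrees exceed \<open>5 k / 2\<close>. Take a longest
  path \<open>e\<^sub>1, \<dots>, e\<^sub>m\<close>, with \<open>m < k\<close>, and ends \<open>s\<close> in \<open>e\<^sub>1\<close> and \<open>a\<close> in \<open>e\<^sub>m\<close>.

  There is no cycle with \<open>m + 1\<close> edges. An edge that met its vertex set \<open>X\<close> in just one vertex would,
  together with all but one edge of the cycle, form a path of \<open>m + 1\<close> edges. So every edge that
  meets \<open>X\<close> contains a pair of vertices of \<open>X\<close>, and by linearity there are at most
  \<open>|X|\<^sup>2 / 2 \<le> 2 k |X|\<close> of them, although \<open>X\<close> meets more than \<open>5 k |X| / 2\<close> edges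
  (\<open>no_loose_cycle_above_longest_path\<close>).

  Call a vertex \<open>v\<close> of the path a contact of \<open>a\<close> if some edge meets the path exactly in \<open>a\<close>
  and \<open>v\<close>. As the path is longest, every edge at \<open>a\<close> meets it in a further vertex; these
  intersections are disjoint, and the path has at most \<open>3 m\<close> vertices besides \<open>a\<close>, so there are at
  least \<open>2 deg(a) - 3 m \<ge> 2 m + 6\<close> contacts (\<open>degree_le_contacts\<close>). The same holds for \<open>s\<close>.
  On the other hand, let \<open>f\<close> join \<open>a\<close> to a contact in \<open>e\<^sub>i\<close>, and \<open>g\<close> join \<open>s\<close> to a
  contact in \<open>e\<^bsub>i+2\<^esub>\<close>. If \<open>f\<close> and \<open>g\<close> were disjoint, they would close the path without
  \<open>e\<^bsub>i+1\<^esub>\<close> to a cycle with \<open>m + 1\<close> edges (\<open>crossing_chords_meet\<close>). So they meet, and they meet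
  outside the path, where \<open>g\<close> has only two vertices, each in at most one edge through \<open>a\<close>. Hence
  if both kinds of contacts occur, there are at most two of each (\<open>card_blocked_contacts\<close>); if only
  one kind occurs, there are at most four. Sum over \<open>i\<close> and add four for each of the last two edges
  on the side of \<open>a\<close> and the first two on the side of \<open>s\<close>: together there are at most
  \<open>4 (m - 2) + 16 = 4 m + 8\<close> contacts. But at least \<open>4 m + 10\<close> remain even if the ends themselves
  are not counted (\<open>exists_loose_path_if_dense\<close>).
\<close>

section \<open>Loose paths and cycles as edge sequences\<close>

text \<open>
  A path is kept as the list of its edges, an induced path in the intersection graph. In a linear
  system consecutive edges then share exactly one vertex, so this is the linear path; cutting,
  reversing and gluing need no choice of an order inside an edge.
\<close>

primrec loose_path :: "'a set list \<Rightarrow> bool" where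
  "loose_path [] \<longleftrightarrow> True"
| "loose_path (e # es) \<longleftrightarrow> loose_path es \<and>
     (es \<noteq> [] \<longrightarrow> e \<noteq> hd es \<and> \<not> disjnt e (hd es) \<and> (\<forall>d\<in>set (tl es). disjnt e d))"

lemma loose_path_append:
  "loose_path (xs @ ys) \<longleftrightarrow> loose_path xs \<and> loose_path ys \<and>
     (xs \<noteq> [] \<longrightarrow> ys \<noteq> [] \<longrightarrow> last xs \<noteq> hd ys \<and> \<not> disjnt (last xs) (hd ys) \<and>
        (\<forall>x\<in>set (butlast xs). \<forall>y\<in>set ys. disjnt x y) \<and>
        (\<forall>y\<in>set (tl ys). disjnt (last xs) y))"
proof (induction xs)
  case Nil
  then show ?case by simp
next
  case (Cons x xs)
  show ?case
  proof (cases "xs = [] \<or> ys = []")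
    case True
    then show ?thesis by (cases xs) auto
  next
    case False
    then have eqs: "xs @ ys \<noteq> []" "hd (xs @ ys) = hd xs" "tl (xs @ ys) = tl xs @ ys" by auto
    show ?thesis using Cons.IH False eqs by (auto simp: ball_Un)
  qed
qed

lemma loose_path_rev: "loose_path (rev es) \<longleftrightarrow> loose_path es"
proof (induction es)
  case Nil
  then show ?case by simp
next
  case (Cons e es)
  then show ?case
    by (auto simp: loose_path_append last_rev butlast_rev dest: disjnt_sym)
qed

text \<open>
  For at least four edges the two paths prescribe how all pairs of edges intersect, except the pair
  of the first and the last edge.
\<close>
definition loose_cycle :: "'a set list \<Rightarrow> bool" where
  "loose_cycle cs \<longleftrightarrow> 4 \<le> length cs \<and> loose_path (butlast cs) \<and> loose_path (tl cs) \<and>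
     hd cs \<noteq> last cs \<and> \<not> disjnt (hd cs) (last cs)"

lemma loose_cycle_split:
  assumes "loose_cycle cs"
  obtains c q z where "cs = c # q @ [z]" "2 \<le> length q"
proof -
  obtain c r where "cs = c # r" using assms by (cases cs) (auto simp: loose_cycle_def)
  moreover obtain q z where "r = q @ [z]"
    using assms calculation by (cases r rule: rev_cases) (auto simp: loose_cycle_def)
  ultimately show ?thesis using assms that by (auto simp: loose_cycle_def)
qed

lemma loose_cycle_iff:
  "loose_cycle (c # (x # y # r) @ [z]) \<longleftrightarrow>
     loose_path (c # x # y # r) \<and> loose_path (x # y # r @ [z]) \<and> c \<noteq> z \<and> \<not> disjnt c z"
  by (simp add: loose_cycle_def butlast_append)

lemma loose_path_snoc:
  "loose_path (es @ [e]) \<longleftrightarrow> loose_path es \<and>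
     (es \<noteq> [] \<longrightarrow> e \<noteq> last es \<and> \<not> disjnt e (last es) \<and> (\<forall>d\<in>set (butlast es). disjnt e d))"
  by (auto simp: loose_path_append disjnt_commute)

lemma loose_cycle_rotate1:
  assumes "loose_cycle cs"
  shows "loose_cycle (rotate1 cs)"
proof -
  obtain c q z where cs: "cs = c # q @ [z]" "2 \<le> length q"
    using assms loose_cycle_split by blast
  obtain x y r where q: "q = x # y # r"
    using cs(2) by (cases q; cases "tl q") auto
  have lp: "loose_path (c # x # y # r)" "loose_path (x # y # r @ [z])" "c \<noteq> z" "\<not> disjnt c z"
    using assms unfolding cs q loose_cycle_iff by blast+
  have "loose_path (y # r @ [z])" using lp(2) by simp
  moreover have "\<forall>d\<in>set (y # r). disjnt c d" using lp(1) by simp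
  ultimately have "loose_path ((y # r @ [z]) @ [c])"
    unfolding loose_path_snoc using lp(3,4) by (simp add: butlast_append)
  then show ?thesis
    using lp unfolding cs q loose_cycle_def by (auto simp: butlast_append disjnt_commute)
qed

lemma loose_cycle_rotate: "loose_cycle cs \<Longrightarrow> loose_cycle (rotate n cs)"
  by (induction n) (auto simp: loose_cycle_rotate1)

text \<open>
  Start with \<open>h\<close>, enter the cycle at an edge \<open>c\<close> through \<open>w\<close> and go round, leaving out the last
  edge. At most one of the two neighbours of \<open>c\<close> contains \<open>w\<close>; the direction is chosen so that this
  neighbour is the edge left out.
\<close>
lemma loose_cycle_pendant_edge:
  assumes cyc: "loose_cycle cs" and h: "h \<inter> \<Union> (set cs) = {w}"
  shows "\<exists>p. loose_path p \<and> length p = length cs \<and> set p \<subseteq> insert h (set cs)"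
proof -
  obtain i where i: "i < length cs" "w \<in> cs ! i"
    using h by (metis IntD2 UnionE in_set_conv_nth insertI1)
  \<comment> \<open>The cycle, rotated so that its first edge contains \<open>w\<close>.\<close>
  define ds where "ds = rotate i cs"
  have ds: "loose_cycle ds" "set ds = set cs" "length ds = length cs"
    using loose_cycle_rotate[OF cyc] by (auto simp: ds_def)
  have "cs \<noteq> []" using i by auto
  then have w: "w \<in> hd ds" using i by (simp add: ds_def hd_rotate_conv_nth)
  obtain c q z where dsq: "ds = c # q @ [z]" "2 \<le> length q"
    using ds loose_cycle_split by blast
  obtain x y r where q: "q = x # y # r"
    using dsq(2) by (cases q; cases "tl q") auto
  have wc: "w \<in> c" using w by (simp add: dsq)
  have wh: "w \<in> h" using h by auto
  have off: "disjnt h d" if "d \<in> set ds" "w \<notin> d" for d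
    using h that ds(2) by (auto simp: disjnt_iff)
  have lp: "loose_path (c # x # y # r)" "loose_path (x # y # r @ [z])" "c \<noteq> z" "\<not> disjnt c z"
    using ds(1) unfolding dsq q loose_cycle_iff by blast+
  have ch: "h \<noteq> c" if "d \<in> set ds" "w \<notin> d" "\<not> disjnt c d" for d
    using off that by blast
  have hc: "\<not> disjnt h c" using wc wh by (auto simp: disjnt_iff)
  have others: "w \<notin> d" if "d \<in> set (y # r)" for d
    using lp(1) wc that by (auto simp: disjnt_iff)
  show ?thesis
  proof (cases "w \<in> x")
    case False
    have "loose_path (h # c # x # y # r)"
      using lp(1) hc ch[of x] off others False
      by (subst loose_path.simps(2)) (auto simp: q dsq)
    then show ?thesis using ds(2,3) dsq(1) q by (intro exI[of _ "h # c # x # y # r"]) auto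
  next
    case True
    then have wz: "w \<notin> z" using lp(2) by (auto simp: disjnt_iff)
    have "loose_path ((y # r @ [z]) @ [c])"
      unfolding loose_path_snoc using lp by (simp add: butlast_append)
    then have "loose_path (c # z # rev (y # r))"
      by (subst loose_path_rev[symmetric]) simp
    moreover have "\<forall>d\<in>set (z # rev (y # r)). disjnt h d"
      using off others wz by (auto simp: q dsq)
    ultimately have "loose_path (h # c # z # rev (y # r))"
      using hc ch[of z] lp(4) wz by (subst loose_path.simps(2)) (auto simp: dsq)
    then show ?thesis
      using ds(2,3) dsq(1) by (intro exI[of _ "h # c # z # rev (y # r)"]) (auto simp: q)
  qed
qed

text \<open>
  The pieces \<open>p\<close> and \<open>r\<close> of the path are joined by \<open>f\<close>, which leads from the end of \<open>p\<close> to the far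
  end \<open>a\<close> of \<open>r\<close>, and by \<open>g\<close>, which leads from the start of \<open>r\<close> back to the start \<open>s\<close> of \<open>p\<close>. The
  conditions on \<open>v\<close> and \<open>u\<close> say that \<open>f\<close> and \<open>g\<close> touch no other edge of these pieces.
\<close>
lemma loose_cycle_from_crossing_chords:
  assumes lp: "loose_path (p @ d # r)" and ne: "p \<noteq> []" "r \<noteq> []"
    and a: "a \<in> last r" "a \<notin> \<Union> (set (p @ d # butlast r))"
    and s: "s \<in> hd p" "s \<notin> \<Union> (set (tl p @ d # r))"
    and f: "f \<inter> \<Union> (set (p @ d # r)) = {a, v}" and v: "v \<in> last p" "v \<notin> \<Union> (set (butlast p))"
    and g: "g \<inter> \<Union> (set (p @ d # r)) = {s, u}" and u: "u \<in> hd r" "u \<notin> \<Union> (set (tl r))"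
    and fg: "disjnt f g"
  shows "loose_cycle (g # p @ f # rev r)"
proof -
  obtain x p' where p: "p = x # p'" using ne by (cases p) auto
  obtain y p'' where p2: "p = p'' @ [y]" using ne by (cases p rule: rev_cases) auto
  obtain z r' where r: "r = z # r'" using ne by (cases r) auto
  obtain t r'' where r2: "r = r'' @ [t]" using ne by (cases r rule: rev_cases) auto
  have lpp: "loose_path p" and lpr: "loose_path r"
    using lp by (auto simp: loose_path_append)
  have pr: "disjnt e e'" if "e \<in> set p" "e' \<in> set r" for e e'
    using lp that loose_path_append[of "p @ [d]" r] ne by simp
  have fsub: "f \<inter> e \<subseteq> {a, v}" and gsub: "g \<inter> e \<subseteq> {s, u}" if "e \<in> set p \<union> set r" for e
    using f g that by auto
  have mem: "x \<in> set p" "y \<in> set p" "z \<in> set r" "t \<in> set r"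
    using p p2 r r2 by (metis list.set_intros(1) last_in_set last_snoc ne)+
  have vr: "v \<notin> e" if "e \<in> set r" for e
    using pr[OF mem(2) that] v by (auto simp: p2 disjnt_iff)
  have up: "u \<notin> e" if "e \<in> set p" for e
    using pr[OF that mem(3)] u by (auto simp: r disjnt_iff)
  have fp: "disjnt f e" if "e \<in> set p''" for e
    using fsub[of e] a v that by (auto simp: p2 disjnt_iff)
  have fr: "disjnt f e" if "e \<in> set r''" for e
    using fsub[of e] a vr that by (auto simp: r2 disjnt_iff)
  have gp: "disjnt g e" if "e \<in> set p'" for e
    using gsub[of e] s up that by (auto simp: p disjnt_iff)
  have gr: "disjnt g e" if "e \<in> set r'" for e
    using gsub[of e] s u that by (auto simp: r disjnt_iff)
  have af: "a \<in> f" "v \<in> f" "s \<in> g" "u \<in> g" using f g by auto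
  have fy: "\<not> disjnt f y" "f \<noteq> y" using af v(1) a(2) by (auto simp: p2 disjnt_iff)
  have ft: "\<not> disjnt f t" "f \<noteq> t" using af a(1) vr mem by (auto simp: r2 disjnt_iff)
  have gx: "\<not> disjnt g x" "g \<noteq> x" using af s(1) up mem by (auto simp: p disjnt_iff)
  have gz: "\<not> disjnt g z" "g \<noteq> z" using af s u(1) by (auto simp: r disjnt_iff)
  have "loose_path (r @ [f])"
    using lpr fr ft unfolding r2 by (subst loose_path_snoc) auto
  then have "loose_path (f # rev r)" using loose_path_rev[of "r @ [f]"] by simp
  moreover have "\<forall>x\<in>set p''. \<forall>e\<in>set (f # rev r). disjnt x e"
    using pr fp by (auto simp: p2 disjnt_commute)
  moreover have "\<forall>e\<in>set (rev r). disjnt y e" using pr mem(2) by simp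
  ultimately have main: "loose_path (p @ f # rev r)"
    using lpp fy unfolding loose_path_append[of p] by (auto simp: p2 disjnt_commute)
  then have "loose_path ((p @ f # rev r') @ [z])" by (simp add: r)
  then have "loose_path (p @ f # rev r')" unfolding loose_path_snoc by blast
  moreover have "\<forall>e\<in>set (p' @ f # rev r'). disjnt g e" 
    using gp gr disjnt_sym[OF fg] by auto
  ultimately have "loose_path (g # p @ f # rev r')"
    using gx by (subst loose_path.simps(2)) (simp add: p)
  then show ?thesis
    using main gz unfolding loose_cycle_def by (simp add: r p butlast_append)
qed

section \<open>Paths in linear quadruple systems\<close>

locale linear_quadruples =
  fixes E :: "'a set set"
  assumes finite_edges: "finite E"
    and card_edge: "e \<in> E \<Longrightarrow> card e = 4"
    and linear: "\<lbrakk>e \<in> E; f \<in> E; x \<in> e; y \<in> e; x \<in> f; y \<in> f; x \<noteq> y\<rbrakk> \<Longrightarrow> e = f"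
begin

lemma finite_edge: "e \<in> E \<Longrightarrow> finite e"
  using card_edge card.infinite by fastforce

lemma edge_Int_singleton:
  assumes "e \<in> E" "f \<in> E" "e \<noteq> f" "\<not> disjnt e f"
  obtains x where "e \<inter> f = {x}"
proof -
  obtain x where x: "x \<in> e" "x \<in> f" using assms(4) by (auto simp: disjnt_iff)
  have "e \<inter> f = {x}" using linear[OF assms(1,2) x(1) _ x(2)] assms(3) x by blast
  then show ?thesis by (rule that)
qed

lemma card_Union_loose_path:
  "loose_path es \<Longrightarrow> set es \<subseteq> E \<Longrightarrow> card (\<Union> (set es)) \<le> 3 * length es + 1"
proof (induction es)
  case Nil
  then show ?case by simp
next
  case (Cons e es)
  then have fin: "finite e" "card e = 4"
    using finite_edge[of e] card_edge[of e] by simp_all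
  show ?case
  proof (cases es)
    case Nil
    then show ?thesis using fin by simp
  next
    case (Cons d ds)
    then have "\<not> disjnt e d" using Cons.prems by auto
    then obtain x where x: "x \<in> e" "x \<in> d" by (auto simp: disjnt_iff)
    have "\<Union> (set (e # es)) = \<Union> (set es) \<union> (e - {x})" using x Cons by auto
    then have "card (\<Union> (set (e # es))) \<le> card (\<Union> (set es)) + card (e - {x})"
      using card_Un_le by metis
    also have "card (e - {x}) = 3" using x fin by simp
    finally show ?thesis using Cons.IH Cons.prems by simp
  qed
qed

lemma loose_path_end_vertex:
  assumes "loose_path es" "set es \<subseteq> E" "es \<noteq> []"
  obtains w where "w \<in> last es" "w \<notin> \<Union> (set (butlast es))"
proof -
  obtain ds e where es: "es = ds @ [e]" using assms(3) by (cases es rule: rev_cases) auto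
  have c4: "card e = 4" using assms(2) card_edge by (auto simp: es)
  have "\<exists>x. e \<inter> \<Union> (set ds) \<subseteq> {x}"
  proof (cases "ds = []")
    case False
    obtain bs d where ds: "ds = bs @ [d]" using False by (cases ds rule: rev_cases) auto
    have "e \<noteq> d" "\<not> disjnt e d" "\<forall>b\<in>set bs. disjnt e b"
      using assms(1) unfolding es loose_path_snoc ds by auto
    moreover obtain x where "e \<inter> d = {x}"
      using edge_Int_singleton[of e d] calculation assms(2) by (auto simp: es ds)
    ultimately have "e \<inter> \<Union> (set ds) \<subseteq> {x}" by (auto simp: ds disjnt_def)
    then show ?thesis ..
  qed simp
  then obtain x where x: "e \<inter> \<Union> (set ds) \<subseteq> {x}" ..
  have "\<not> e \<subseteq> {x}" using c4 card_mono[of "{x}" e] by auto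
  then obtain w where "w \<in> e" "w \<noteq> x" by auto
  then show ?thesis using x that[of w] by (auto simp: es)
qed

text \<open>
  The labelling \<open>x\<close> is the one in the definition of the linear path. It is extended edge by edge;
  the last label must sit on the vertex that the next edge shares, so the induction needs a
  prescribed free vertex \<open>w\<close> of the last edge to receive it.
\<close>
lemma loose_path_vertex_labelling:
  assumes "loose_path es" "set es \<subseteq> E" "es \<noteq> []" "w \<in> last es" "w \<notin> \<Union> (set (butlast es))"
  shows "\<exists>x. inj_on x {1..3 * length es + 1} \<and> x ` {1..3 * length es + 1} = \<Union> (set es) \<and>
    x (3 * length es + 1) = w \<and>
    (\<forall>i<length es. es ! i = x ` {3 * i + 1, 3 * i + 2, 3 * i + 3, 3 * i + 4})"
  using assms
proof (induction es arbitrary: w rule: rev_induct)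
  case Nil
  then show ?case by simp
next
  case (snoc e es)
  have e: "e \<in> E" "card e = 4" "finite e" "w \<in> e" using snoc.prems card_edge finite_edge by auto
  show ?case
  proof (cases "es = []")
    case True
    have "card (e - {w}) = 3" using e by simp
    then obtain p q r where pqr: "e - {w} = {p, q, r}" "p \<noteq> q" "q \<noteq> r" "p \<noteq> r"
      by (auto simp: card_3_iff)
    then have ee: "e = {p, q, r, w}" "w \<noteq> p" "w \<noteq> q" "w \<noteq> r" using e(4) by auto
    define x where "x = (\<lambda>i::nat. if i = 1 then p else if i = 2 then q else if i = 3 then r else w)"
    have four: "{1..3 * length (es @ [e]) + 1} = {1, 2, 3, 4::nat}" using True by auto
    show ?thesis
      unfolding four using True ee pqr(2-4)
      by (intro exI[of _ x]) (auto simp: x_def inj_on_def)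
  next
    case False
    let ?n = "length es"
    let ?U = "\<Union> (set es)"
    obtain ds d where es: "es = ds @ [d]" using False by (cases es rule: rev_cases) auto
    have lp: "loose_path es" "e \<noteq> d" "\<not> disjnt e d" "\<forall>b\<in>set ds. disjnt e b"
      using snoc.prems(1) unfolding loose_path_snoc[of es] by (auto simp: es)
    obtain w' where w': "e \<inter> d = {w'}"
      using edge_Int_singleton[of e d] lp snoc.prems(2) by (auto simp: es)
    have eU: "e \<inter> ?U = {w'}" using w' lp(4) by (auto simp: es disjnt_def)
    have "w' \<in> last es" "w' \<notin> \<Union> (set (butlast es))"
      using w' lp(4) by (auto simp: es disjnt_iff)
    then obtain x where x: "inj_on x {1..3 * ?n + 1}" "x ` {1..3 * ?n + 1} = ?U"
      "x (3 * ?n + 1) = w'"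
      "\<And>i. i < ?n \<Longrightarrow> es ! i = x ` {3 * i + 1, 3 * i + 2, 3 * i + 3, 3 * i + 4}"
      using snoc.IH[of w'] lp(1) snoc.prems(2) False by auto
    have wU: "w \<notin> ?U" using snoc.prems(5) by simp
    have ww: "w \<noteq> w'" "w' \<in> e" using wU eU by auto
    have "card (e - {w, w'}) = 2" using e ww by (simp add: card_Diff_subset)
    then obtain p q where pq: "e - {w, w'} = {p, q}" "p \<noteq> q" by (auto simp: card_2_iff)
    have ee: "e = {w', p, q, w}" using pq e(4) ww by auto
    have fresh: "p \<notin> ?U" "q \<notin> ?U" "w \<notin> ?U" "p \<noteq> w" "q \<noteq> w" using pq eU wU by auto
    define x' where "x' = x(3 * ?n + 2 := p, 3 * ?n + 3 := q, 3 * ?n + 4 := w)"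
    have old: "x' i = x i" if "i \<le> 3 * ?n + 1" for i using that by (simp add: x'_def)
    have new: "x' (3 * ?n + 2) = p" "x' (3 * ?n + 3) = q" "x' (3 * ?n + 4) = w"
      by (simp_all add: x'_def)
    have split: "{1..3 * length (es @ [e]) + 1} =
        {1..3 * ?n + 1} \<union> {3 * ?n + 2, 3 * ?n + 3, 3 * ?n + 4}" by auto
    have im: "x' ` {1..3 * ?n + 1} = ?U" using x(2) old by (metis atLeastAtMost_iff image_cong)
    have "inj_on x' {1..3 * ?n + 1}" using x(1) old by (metis (no_types, lifting) atLeastAtMost_iff inj_on_cong)
    moreover have "inj_on x' {3 * ?n + 2, 3 * ?n + 3, 3 * ?n + 4}"
      unfolding inj_on_def using new fresh pq(2) by auto
    moreover have "x' ` {1..3 * ?n + 1} \<inter> x' ` {3 * ?n + 2, 3 * ?n + 3, 3 * ?n + 4} = {}"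
      unfolding im using new fresh by auto
    ultimately have "inj_on x' {1..3 * length (es @ [e]) + 1}"
      unfolding split inj_on_Un by blast
    moreover have "x' ` {1..3 * length (es @ [e]) + 1} = \<Union> (set (es @ [e]))"
      unfolding split image_Un im using new ee eU by auto
    moreover have "x' (3 * length (es @ [e]) + 1) = w" using new by (simp add: algebra_simps)
    moreover have "(es @ [e]) ! i = x' ` {3 * i + 1, 3 * i + 2, 3 * i + 3, 3 * i + 4}"
      if "i < length (es @ [e])" for i
    proof (cases "i < ?n")
      case True
      then have "x' ` {3 * i + 1, 3 * i + 2, 3 * i + 3, 3 * i + 4} =
          x ` {3 * i + 1, 3 * i + 2, 3 * i + 3, 3 * i + 4}"
        by (intro image_cong) (auto simp: old)
      then show ?thesis using True x(4) by (simp add: nth_append)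
    next
      case False
      then have "i = ?n" using that by simp
      then show ?thesis using new old[of "3 * ?n + 1"] x(3) ee by simp
    qed
    ultimately show ?thesis by (intro exI[of _ x']) blast
  qed
qed

section \<open>Longest paths and the edges at their ends\<close>

definition contacts :: "'a set list \<Rightarrow> 'a \<Rightarrow> 'a set" where
  "contacts es a = {v. v \<noteq> a \<and> (\<exists>f\<in>E. f \<inter> \<Union> (set es) = {a, v})}"

text \<open>
  The sets \<open>T f\<close> of further path vertices on the edges \<open>f\<close> at \<open>a\<close> are disjoint by linearity, and
  nonempty since otherwise \<open>f\<close> would prolong the path. All together they have at most \<open>3 m\<close>
  elements, \<open>m\<close> being the number of edges of the path, and the sets with a single element give
  the contacts.
\<close>
lemma degree_le_contacts:
  assumes es: "loose_path es" "set es \<subseteq> E" "es \<noteq> []"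
    and a: "a \<in> last es" "a \<notin> \<Union> (set (butlast es))"
    and longest: "\<And>p. loose_path p \<Longrightarrow> set p \<subseteq> E \<Longrightarrow> length p \<le> length es"
  shows "2 * card {f \<in> E. a \<in> f} \<le> 3 * length es + card (contacts es a)"
proof -
  define W where "W = \<Union> (set es)"
  define F where "F = {f \<in> E. a \<in> f}"
  define T where "T f = f \<inter> W - {a}" for f
  define F1 where "F1 = {f \<in> F. card (T f) = 1}"
  have finW: "finite W" using es(2) finite_edge by (auto simp: W_def)
  have aW: "a \<in> W" using a(1) es(3) by (auto simp: W_def)
  have finF: "finite F" "finite F1" using finite_edges by (auto simp: F_def F1_def)
  have finT: "finite (T f)" for f using finW by (auto simp: T_def)
  have disj: "T f \<inter> T f' = {}" if "f \<in> F" "f' \<in> F" "f \<noteq> f'" for f f'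
    using linear[of f f' a] that by (auto simp: T_def F_def)
  have "T f \<noteq> {}" if f: "f \<in> F" for f
  proof
    assume "T f = {}"
    then have fW: "f \<inter> W = {a}" using f aW by (auto simp: T_def F_def)
    have "f \<noteq> last es"
    proof
      assume "f = last es"
      then have "f \<subseteq> W" using last_in_set[OF es(3)] unfolding W_def by blast
      then have "f = {a}" using fW by auto
      then show False using card_edge[of f] f by (auto simp: F_def)
    qed
    moreover have "\<not> disjnt f (last es)" using f a(1) by (auto simp: F_def disjnt_iff)
    moreover have "\<forall>d\<in>set (butlast es). disjnt f d"
    proof
      fix d assume d: "d \<in> set (butlast es)"
      then have "d \<subseteq> W" using in_set_butlastD[OF d] by (auto simp: W_def)
      then have "f \<inter> d \<subseteq> {a}" using fW by blast
      moreover have "a \<notin> d" using a(2) d by blast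
      ultimately show "disjnt f d" by (auto simp: disjnt_iff)
    qed
    ultimately have "loose_path (es @ [f])" using es(1) by (simp add: loose_path_snoc)
    then show False using longest[of "es @ [f]"] f es(2) by (auto simp: F_def)
  qed
  then have pos: "card (T f) > 0" if "f \<in> F" for f
    using finT that by (simp add: card_gt_0_iff)
  have "2 * card F = (\<Sum>f\<in>F. 2)" by simp
  also have "\<dots> \<le> (\<Sum>f\<in>F. card (T f) + (if f \<in> F1 then 1 else 0))"
  proof (rule sum_mono)
    fix f assume "f \<in> F"
    then show "2 \<le> card (T f) + (if f \<in> F1 then 1 else 0)"
      using pos[of f] by (cases "card (T f) = 1") (simp_all add: F1_def)
  qed
  also have "\<dots> = (\<Sum>f\<in>F. card (T f)) + card F1"
  proof -
    have "F1 \<subseteq> F" by (auto simp: F1_def)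
    then have "(\<Sum>f\<in>F. if f \<in> F1 then 1 else 0) = card F1"
      using finF(1) by (simp add: sum.If_cases Int_absorb1)
    then show ?thesis by (simp add: sum.distrib)
  qed
  also have "(\<Sum>f\<in>F. card (T f)) = card (\<Union>f\<in>F. T f)"
    using finF finT disj by (subst card_UN_disjoint) auto
  also have "\<dots> \<le> card (W - {a})"
    using finW by (intro card_mono) (auto simp: T_def)
  also have "card (W - {a}) \<le> 3 * length es"
    using card_Union_loose_path[OF es(1,2)] finW aW by (simp add: W_def)
  also have "card F1 = (\<Sum>f\<in>F1. card (T f))" by (simp add: F1_def)
  also have "\<dots> = card (\<Union>f\<in>F1. T f)"
    using finF finT disj by (subst card_UN_disjoint) (auto simp: F1_def)
  also have "\<dots> \<le> card (contacts es a)"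
  proof (rule card_mono)
    have "contacts es a \<subseteq> W" by (auto simp: contacts_def W_def)
    then show "finite (contacts es a)" using finW finite_subset by blast
    show "(\<Union>f\<in>F1. T f) \<subseteq> contacts es a"
    proof clarify
      fix f v assume f: "f \<in> F1" and v: "v \<in> T f"
      then have "T f = {v}" by (auto simp: F1_def card_1_singleton_iff)
      then have "f \<inter> W = {a, v}" "v \<noteq> a" using f aW by (auto simp: T_def F1_def F_def)
      then show "v \<in> contacts es a" using f by (auto simp: contacts_def W_def F1_def F_def)
    qed
  qed
  finally show ?thesis by (simp add: F_def)
qed

text \<open>
  Outside \<open>W\<close> the edge \<open>g\<close> has only two vertices, and each of them lies in at most one edge
  through \<open>a\<close>.
\<close>
lemma card_blocked_contacts:
  assumes g: "g \<in> E" "g \<inter> W = {s, u}" "s \<noteq> u" and a: "a \<in> W" "a \<notin> g"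
    and A: "\<And>v. v \<in> A \<Longrightarrow> v \<noteq> a \<and> v \<notin> g \<and> (\<exists>f\<in>E. f \<inter> W = {a, v} \<and> \<not> disjnt f g)"
  shows "card A \<le> 2"
proof -
  obtain f where f: "\<And>v. v \<in> A \<Longrightarrow> f v \<in> E \<and> f v \<inter> W = {a, v} \<and> \<not> disjnt (f v) g"
    using A by metis
  then have "\<exists>t. t \<in> f v \<and> t \<in> g" if "v \<in> A" for v using that by (auto simp: disjnt_iff)
  then obtain t where t: "\<And>v. v \<in> A \<Longrightarrow> t v \<in> f v \<and> t v \<in> g" by metis
  have tW: "t v \<notin> W" if "v \<in> A" for v
  proof
    assume "t v \<in> W"
    then have "t v \<in> {a, v}" using f[OF that] t[OF that] by blast
    then show False using a(2) A[OF that] t[OF that] by auto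
  qed
  have "inj_on t A"
  proof (rule inj_onI)
    fix v v' assume v: "v \<in> A" "v' \<in> A" "t v = t v'"
    have "f v = f v'"
      using linear[of "f v" "f v'" a "t v"] f[OF v(1)] f[OF v(2)] t[OF v(1)] t[OF v(2)] v(3)
        tW[OF v(1)] a(1) by auto
    then have "{a, v} = {a, v'}" using f v by metis
    then show "v = v'" using A v by (auto simp: doubleton_eq_iff)
  qed
  moreover have "t ` A \<subseteq> g - {s, u}" using t tW g(2) by auto
  moreover have "card (g - {s, u}) = 2"
  proof -
    have "{s, u} \<subseteq> g" using g(2) by auto
    then show ?thesis using card_edge[OF g(1)] g(3) by (simp add: card_Diff_subset)
  qed
  ultimately show ?thesis using finite_edge[OF g(1)] card_inj_on_le[of t A "g - {s, u}"] by simp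
qed

text \<open>
  Every edge that meets the vertex set \<open>X\<close> of the cycle meets it twice, so it contains two of the
  \<open>|X|\<^sup>2\<close> ordered pairs over \<open>X\<close>, and no pair lies in two edges. As \<open>|X| \<le> 4 k\<close>, this leaves room
  for fewer edges than the density requires.
\<close>
lemma no_loose_cycle_above_longest_path:
  assumes dense: "\<And>X. X \<subseteq> \<Union> E \<Longrightarrow> X \<noteq> {} \<Longrightarrow> 5 * k * card X < 2 * card {e \<in> E. \<not> disjnt e X}"
    and short: "\<And>p. loose_path p \<Longrightarrow> set p \<subseteq> E \<Longrightarrow> length p < length cs"
    and cs: "loose_cycle cs" "set cs \<subseteq> E" "length cs \<le> k"
  shows False
proof -
  define X where "X = \<Union> (set cs)"
  define M where "M = {e \<in> E. \<not> disjnt e X}"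
  define T where "T h = {(x, y). x \<in> h \<inter> X \<and> y \<in> h \<inter> X \<and> x \<noteq> y}" for h
  have finX: "finite X" using cs(2) finite_edge by (auto simp: X_def)
  have finM: "finite M" using finite_edges by (simp add: M_def)
  have "cs \<noteq> []" using cs(1) by (auto simp: loose_cycle_def)
  then have "hd cs \<in> E" "hd cs \<subseteq> X" using cs(2) hd_in_set[of cs] unfolding X_def by blast+
  then have "X \<noteq> {}" using card_edge[of "hd cs"] by auto
  moreover have "X \<subseteq> \<Union> E" using cs(2) by (auto simp: X_def)
  ultimately have big: "5 * k * card X < 2 * card M" unfolding M_def by (rule dense[rotated])
  have "card X \<le> (\<Sum>e\<in>set cs. card e)" unfolding X_def by (rule card_Union_le_sum_card)
  also have "\<dots> = (\<Sum>e\<in>set cs. 4)" using cs(2) card_edge by (intro sum.cong) auto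
  also have "\<dots> \<le> 4 * k" using card_length[of cs] cs(3) by simp
  finally have X4: "card X \<le> 4 * k" .
  have T_sub: "T h \<subseteq> X \<times> X" for h by (auto simp: T_def)
  have T2: "2 \<le> card (T h)" if h: "h \<in> M" for h
  proof -
    obtain w where w: "w \<in> h \<inter> X" using h by (auto simp: M_def disjnt_iff)
    have "h \<inter> X \<noteq> {w}"
    proof
      assume "h \<inter> X = {w}"
      then obtain p where "loose_path p" "length p = length cs" "set p \<subseteq> insert h (set cs)"
        using loose_cycle_pendant_edge[OF cs(1)] unfolding X_def by blast
      then show False using short[of p] cs(2) h by (auto simp: M_def)
    qed
    then obtain w' where w': "w' \<in> h \<inter> X" "w' \<noteq> w" using w by auto
    have "card {(w, w'), (w', w)} \<le> card (T h)"
      using w w' finX T_sub by (intro card_mono) (auto simp: T_def intro: finite_subset)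
    then show ?thesis using w' by simp
  qed
  have "2 * card M = (\<Sum>h\<in>M. 2)" by simp
  also have "\<dots> \<le> (\<Sum>h\<in>M. card (T h))" using T2 by (rule sum_mono)
  also have "\<dots> = card (\<Union>h\<in>M. T h)"
  proof (rule card_UN_disjoint[symmetric])
    show "\<forall>h\<in>M. finite (T h)" using finite_subset[OF T_sub] finX by auto
    have "h = h'" if "h \<in> M" "h' \<in> M" "(x, y) \<in> T h" "(x, y) \<in> T h'" for h h' x y
      using linear[of h h' x y] that by (auto simp: M_def T_def)
    then show "\<forall>h\<in>M. \<forall>h'\<in>M. h \<noteq> h' \<longrightarrow> T h \<inter> T h' = {}" by fast
  qed (rule finM)
  also have "\<dots> \<le> card (X \<times> X)" using T_sub finX by (intro card_mono) auto
  also have "\<dots> \<le> 4 * k * card X" using X4 by (simp add: card_cartesian_product)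
  finally show False using big by (simp add: mult.assoc)
qed

text \<open>
  Otherwise \<open>f\<close> and \<open>g\<close> would replace the edge \<open>es ! (i + 1)\<close> and close up a cycle. For this \<open>f\<close>
  must touch only the last of the edges before the gap, and \<open>g\<close> only the first one after it; hence
  \<open>v\<close> is not on an earlier edge and \<open>u\<close> not on a later one.
\<close>
lemma crossing_chords_meet:
  assumes es: "loose_path es" "set es \<subseteq> E" "i + 2 < length es"
    and longest: "\<And>p. loose_path p \<Longrightarrow> set p \<subseteq> E \<Longrightarrow> length p \<le> length es"
    and no_cycle: "\<And>cs. loose_cycle cs \<Longrightarrow> set cs \<subseteq> E \<Longrightarrow> length cs \<noteq> length es + 1"
    and a: "a \<in> last es" "a \<notin> \<Union> (set (butlast es))"
    and s: "s \<in> hd es" "s \<notin> \<Union> (set (tl es))"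
    and f: "f \<in> E" "f \<inter> \<Union> (set es) = {a, v}" "v \<in> es ! i - \<Union> (set (take i es))"
    and g: "g \<in> E" "g \<inter> \<Union> (set es) = {s, u}" "u \<in> es ! (i + 2) - \<Union> (set (drop (i + 3) es))"
  shows "\<not> disjnt f g"
proof
  assume fg: "disjnt f g"
  define p where "p = take (Suc i) es"
  define d where "d = es ! Suc i"
  define r where "r = drop (Suc (Suc i)) es"
  have split: "es = p @ d # r"
    unfolding p_def d_def r_def using es(3) by (intro id_take_nth_drop) simp
  have p: "p = take i es @ [es ! i]"
    unfolding p_def using es(3) by (simp add: take_Suc_conv_app_nth)
  have r: "r = es ! (i + 2) # drop (i + 3) es"
    unfolding r_def using es(3) Cons_nth_drop_Suc[of "i + 2" es] by (simp add: numeral_eq_Suc)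
  have ne: "p \<noteq> []" "r \<noteq> []" using p r by auto
  have "loose_cycle (g # p @ f # rev r)"
  proof (rule loose_cycle_from_crossing_chords[where d = d and a = a and s = s and v = v and u = u])
    show "loose_path (p @ d # r)" using es(1) split by simp
    show "a \<in> last r" "a \<notin> \<Union> (set (p @ d # butlast r))"
      using a ne unfolding split by (simp_all add: butlast_append)
    show "s \<in> hd p" "s \<notin> \<Union> (set (tl p @ d # r))"
      using s ne unfolding split by simp_all
    show "v \<in> last p" "v \<notin> \<Union> (set (butlast p))" using f(3) by (simp_all add: p)
    show "u \<in> hd r" "u \<notin> \<Union> (set (tl r))" using g(3) by (simp_all add: r)
  qed (use f g fg ne split in simp_all)
  moreover have "set (g # p @ f # rev r) \<subseteq> E" using es(2) f(1) g(1) unfolding split by auto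
  moreover have "length (g # p @ f # rev r) = length es + 1" unfolding split by simp
  ultimately show False using no_cycle by blast
qed

text \<open>
  The contacts \<open>A\<close> of \<open>a\<close> and \<open>S\<close> of \<open>s\<close> on a longest path are counted in two ways: the degrees
  give at least \<open>4 m + 10\<close>, while the restrictions on contacts two edges apart give at most
  \<open>4 (m - 2) + 16\<close>.
\<close>
lemma exists_loose_path_if_dense:
  assumes dense: "\<And>X. X \<subseteq> \<Union> E \<Longrightarrow> X \<noteq> {} \<Longrightarrow> 5 * k * card X < 2 * card {e \<in> E. \<not> disjnt e X}"
    and ne: "E \<noteq> {}"
  shows "\<exists>es. loose_path es \<and> set es \<subseteq> E \<and> length es = k"
proof (rule ccontr)
  assume none: "\<not> ?thesis"
  have short: "length p < k" if "loose_path p" "set p \<subseteq> E" for p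
  proof (rule ccontr)
    assume "\<not> length p < k"
    moreover have "loose_path (take k p)"
      using that(1) loose_path_append[of "take k p" "drop k p"] by simp
    moreover have "set (take k p) \<subseteq> E" using that(2) set_take_subset[of k p] by blast
    ultimately show False using none by (metis length_take min.absorb2 not_less)
  qed
  obtain e where e: "e \<in> E" using ne by auto
  obtain es where es: "loose_path es" "set es \<subseteq> E"
    and longest: "\<And>p. loose_path p \<Longrightarrow> set p \<subseteq> E \<Longrightarrow> length p \<le> length es"
    using ex_has_greatest_nat[of "\<lambda>p. loose_path p \<and> set p \<subseteq> E" "[e]" length k] short e
    by (auto simp: less_imp_le)
  define m where "m = length es"
  define W where "W = \<Union> (set es)"
  have mk: "m < k" using short es by (simp add: m_def)
  have "length [e] \<le> m" unfolding m_def using e by (intro longest) auto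
  then have es_ne: "es \<noteq> []" by (auto simp: m_def)
  have finW: "finite W" using es(2) finite_edge by (auto simp: W_def)
  have no_cycle: "length cs \<noteq> length es + 1" if "loose_cycle cs" "set cs \<subseteq> E" for cs
  proof
    assume l: "length cs = length es + 1"
    show False
    proof (rule no_loose_cycle_above_longest_path[of k cs])
      show "length p < length cs" if "loose_path p" "set p \<subseteq> E" for p
        using longest[OF that] l by simp
    qed (use dense that l mk m_def in auto)
  qed
  have deg: "5 * m + 6 \<le> 2 * card {e \<in> E. v \<in> e}" if "v \<in> W" for v
  proof -
    have "v \<in> \<Union> E" using that es(2) by (auto simp: W_def)
    then have "5 * k < 2 * card {e \<in> E. v \<in> e}" using dense[of "{v}"] by simp
    then show ?thesis using mk by simp
  qed
  obtain a where a: "a \<in> last es" "a \<notin> \<Union> (set (butlast es))"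
    using loose_path_end_vertex es es_ne by blast
  have rev_es: "loose_path (rev es)" "set (rev es) \<subseteq> E" "rev es \<noteq> []"
    using es es_ne loose_path_rev by auto
  then obtain s where s': "s \<in> last (rev es)" "s \<notin> \<Union> (set (butlast (rev es)))"
    using loose_path_end_vertex by blast
  then have s: "s \<in> hd es" "s \<notin> \<Union> (set (tl es))" by (simp_all add: last_rev butlast_rev)
  have aW: "a \<in> W" and sW: "s \<in> W"
    using a(1) s(1) last_in_set[OF es_ne] hd_in_set[OF es_ne] unfolding W_def by blast+
  have conW: "contacts es x \<subseteq> W" for x by (auto simp: contacts_def W_def)
  \<comment> \<open>An edge through both ends would belong to both families of chords, so the ends are removed.\<close>
  define A where "A = contacts es a - {s}"
  define S where "S = contacts es s - {a}"
  have AW: "A \<subseteq> W" and SW: "S \<subseteq> W" using conW by (auto simp: A_def S_def)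
  then have finA: "finite A" "finite S" using finW finite_subset by blast+
  have "2 * m + 6 \<le> card (contacts es a)"
    using degree_le_contacts[OF es es_ne a longest] deg[OF aW] by (simp add: m_def)
  then have cardA: "2 * m + 5 \<le> card A"
    unfolding A_def by (intro order_trans[OF _ diff_card_le_card_Diff]) auto
  have "2 * m + 6 \<le> card (contacts es s)"
    using degree_le_contacts[OF rev_es s'] longest deg[OF sW] by (simp add: m_def contacts_def)
  then have cardS: "2 * m + 5 \<le> card S"
    unfolding S_def by (intro order_trans[OF _ diff_card_le_card_Diff]) auto
  have "card A \<le> card W" using AW finW by (rule card_mono[rotated])
  also have "card W \<le> 3 * m + 1" unfolding W_def m_def by (rule card_Union_loose_path[OF es])
  finally have "4 \<le> m" using cardA by simp
  define j where "j = m - 2"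
  have j: "m = Suc (Suc j)" using \<open>4 \<le> m\<close> by (simp add: j_def)
  \<comment> \<open>Each vertex belongs to \<open>B i\<close> for the first, and to \<open>D i\<close> for the last edge \<open>es ! i\<close> through it.\<close>
  define B where "B i = es ! i - \<Union> (set (take i es))" for i
  define D where "D i = es ! i - \<Union> (set (drop (Suc i) es))" for i
  have cardBD: "card (A \<inter> B i) \<le> 4" "card (S \<inter> D i) \<le> 4" if "i < m" for i
  proof -
    have "es ! i \<in> E" using es(2) that by (auto simp: m_def)
    then have "finite (es ! i)" "card (es ! i) = 4" using finite_edge card_edge by auto
    moreover have "A \<inter> B i \<subseteq> es ! i" "S \<inter> D i \<subseteq> es ! i" by (auto simp: B_def D_def)
    ultimately show "card (A \<inter> B i) \<le> 4" "card (S \<inter> D i) \<le> 4" by (metis card_mono)+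
  qed
  have coverB: "\<exists>i<m. v \<in> B i" and coverD: "\<exists>i<m. v \<in> D i" if "v \<in> W" for v
  proof -
    have ex: "\<exists>e\<in>set es. v \<in> e" using that by (auto simp: W_def)
    obtain ys e zs where "es = ys @ e # zs" "v \<in> e" "\<forall>y\<in>set ys. v \<notin> y"
      using split_list_first_prop[OF ex] by blast
    then show "\<exists>i<m. v \<in> B i" by (intro exI[of _ "length ys"]) (auto simp: m_def B_def)
    obtain ys e zs where "es = ys @ e # zs" "v \<in> e" "\<forall>y\<in>set zs. v \<notin> y"
      using split_list_last_prop[OF ex] by blast
    then show "\<exists>i<m. v \<in> D i" by (intro exI[of _ "length ys"]) (auto simp: m_def D_def)
  qed
  have pair: "card (A \<inter> B i) + card (S \<inter> D (i + 2)) \<le> 4" if i: "i < j" for i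
  proof (cases "A \<inter> B i = {} \<or> S \<inter> D (i + 2) = {}")
    case True
    then show ?thesis using cardBD(1)[of i] cardBD(2)[of "i + 2"] i j by auto
  next
    case False
    have il: "i + 2 < length es" using i j by (simp add: m_def)
    have meet: "\<not> disjnt f g"
      if "f \<in> E" "f \<inter> W = {a, v}" "v \<in> B i" "g \<in> E" "g \<inter> W = {s, u}" "u \<in> D (i + 2)" for f g v u
      using crossing_chords_meet[OF es il longest no_cycle a s] that
      by (simp add: W_def B_def D_def numeral_3_eq_3)
    have "disjnt (es ! i) (es ! (i + 2))"
    proof -
      have "es = take (i + 2) es @ es ! (i + 2) # drop (Suc (i + 2)) es"
        by (rule id_take_nth_drop[OF il])
      moreover have "take (i + 2) es = take (Suc i) es @ [es ! Suc i]"
        using take_Suc_conv_app_nth[of "Suc i" es] il by simp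
      moreover have "es ! i \<in> set (take (Suc i) es)"
        using il by (simp add: take_Suc_conv_app_nth)
      ultimately show ?thesis using es(1) loose_path_append[of "take (i + 2) es" "drop (i + 2) es"]
        by (metis append_is_Nil_conv append_take_drop_id butlast_snoc list.distinct(1)
            list.set_intros(1) same_append_eq)
    qed
    then have vu: "v \<noteq> u" if "v \<in> B i" "u \<in> D (i + 2)" for v u
      using that by (auto simp: B_def D_def disjnt_iff)
    have as: "a \<noteq> s"
    proof -
      obtain x y ys where "es = x # y # ys" using j unfolding m_def by (metis length_Suc_conv)
      then show ?thesis using a(1) s(2) by (auto split: if_splits)
    qed
    have Af: "v \<noteq> a \<and> v \<noteq> s \<and> v \<in> W \<and> (\<exists>f\<in>E. f \<inter> W = {a, v})" if "v \<in> A" for v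
      using that AW by (auto simp: A_def contacts_def W_def)
    have Sg: "u \<noteq> s \<and> u \<noteq> a \<and> u \<in> W \<and> (\<exists>g\<in>E. g \<inter> W = {s, u})" if "u \<in> S" for u
      using that SW by (auto simp: S_def contacts_def W_def)
    obtain v u where v: "v \<in> A" "v \<in> B i" and u: "u \<in> S" "u \<in> D (i + 2)" using False by auto
    obtain f where f: "f \<in> E" "f \<inter> W = {a, v}" using Af[OF v(1)] by auto
    obtain g where g: "g \<in> E" "g \<inter> W = {s, u}" using Sg[OF u(1)] by auto
    have "card (A \<inter> B i) \<le> 2"
    proof (rule card_blocked_contacts[OF g])
      show "a \<notin> g" using g(2) aW as Sg[OF u(1)] by auto
      show "x \<noteq> a \<and> x \<notin> g \<and> (\<exists>f\<in>E. f \<inter> W = {a, x} \<and> \<not> disjnt f g)" if x: "x \<in> A \<inter> B i" for x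
      proof -
        have "x \<in> W" "x \<noteq> s" "x \<noteq> u" "x \<noteq> a" using x Af vu u(2) by auto
        then have "x \<notin> g" using g(2) by auto
        then show ?thesis using x Af[of x] meet[OF _ _ _ g u(2), of _ x] by auto
      qed
    qed (use Sg[OF u(1)] aW in auto)
    moreover have "card (S \<inter> D (i + 2)) \<le> 2"
    proof (rule card_blocked_contacts[OF f])
      show "s \<notin> f" using f(2) sW as Af[OF v(1)] by auto
      show "x \<noteq> s \<and> x \<notin> f \<and> (\<exists>g\<in>E. g \<inter> W = {s, x} \<and> \<not> disjnt g f)"
        if x: "x \<in> S \<inter> D (i + 2)" for x
      proof -
        have "x \<in> W" "x \<noteq> s" "x \<noteq> v" "x \<noteq> a" using x Sg vu v(2) by auto
        then have "x \<notin> f" using f(2) by auto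
        obtain h where h: "h \<in> E" "h \<inter> W = {s, x}" using x Sg[of x] by auto
        have "\<not> disjnt f h" using meet[OF f v(2) h] x by simp
        then have "\<not> disjnt h f" by (simp add: disjnt_commute)
        then show ?thesis using h \<open>x \<noteq> s\<close> \<open>x \<notin> f\<close> by blast
      qed
    qed (use Af[OF v(1)] sW in auto)
    ultimately show ?thesis by simp
  qed
  \<comment> \<open>The last two edges for \<open>A\<close> and the first two for \<open>S\<close> have no partner two edges further.\<close>
  have "card A \<le> card (\<Union>i<m. A \<inter> B i)"
    using coverB AW finA by (intro card_mono) auto
  also have "\<dots> \<le> (\<Sum>i<m. card (A \<inter> B i))" by (rule card_UN_le) simp
  also have "\<dots> = (\<Sum>i<j. card (A \<inter> B i)) + card (A \<inter> B j) + card (A \<inter> B (Suc j))"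
    by (simp add: j)
  also have "\<dots> \<le> (\<Sum>i<j. card (A \<inter> B i)) + 8"
    using cardBD(1)[of j] cardBD(1)[of "Suc j"] j by simp
  finally have A_le: "card A \<le> (\<Sum>i<j. card (A \<inter> B i)) + 8" .
  have "card S \<le> card (\<Union>i<m. S \<inter> D i)"
    using coverD SW finA by (intro card_mono) auto
  also have "\<dots> \<le> (\<Sum>i<m. card (S \<inter> D i))" by (rule card_UN_le) simp
  also have "\<dots> = card (S \<inter> D 0) + card (S \<inter> D 1) + (\<Sum>i<j. card (S \<inter> D (i + 2)))"
    unfolding j sum.lessThan_Suc_shift by simp
  also have "\<dots> \<le> 8 + (\<Sum>i<j. card (S \<inter> D (i + 2)))"
    using cardBD(2)[of 0] cardBD(2)[of 1] j by simp
  finally have S_le: "card S \<le> 8 + (\<Sum>i<j. card (S \<inter> D (i + 2)))" .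
  have "(\<Sum>i<j. card (A \<inter> B i)) + (\<Sum>i<j. card (S \<inter> D (i + 2))) \<le> (\<Sum>i<j. 4)"
    unfolding sum.distrib[symmetric] using pair by (intro sum_mono) auto
  then show False using A_le S_le cardA cardS j by simp
qed

end

section \<open>The upper bound\<close>

lemma loose_path_not_free:
  assumes H: "linear_quadruples (edges H)" "\<Union> (edges H) \<subseteq> verts H"
    and es: "loose_path es" "set es \<subseteq> edges H" "es \<noteq> []"
  shows "\<not> is_free (linear_path4 (length es)) H"
proof -
  interpret linear_quadruples "edges H" by fact
  obtain w where "w \<in> last es" "w \<notin> \<Union> (set (butlast es))"
    using loose_path_end_vertex es by blast
  then obtain x where x: "inj_on x {1..3 * length es + 1}"
      "x ` {1..3 * length es + 1} = \<Union> (set es)"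
      "\<And>i. i < length es \<Longrightarrow> es ! i = x ` {3 * i + 1, 3 * i + 2, 3 * i + 3, 3 * i + 4}"
    using loose_path_vertex_labelling[OF es] by blast
  let ?K = "(\<Union> (set es), set es)"
  have "subhypergraph ?K H"
    using H(2) es(2) by (auto simp: subhypergraph_def)
  moreover have "set es = (\<lambda>e. x ` e) ` edges (linear_path4 (length es))"
  proof -
    have "{1..length es} = Suc ` {..<length es}"
      by (metis One_nat_def atLeast0LessThan atLeastLessThanSuc_atLeastAtMost image_Suc_atLeastLessThan)
    then have "(\<lambda>e. x ` e) ` edges (linear_path4 (length es)) =
        (\<lambda>i. x ` {3 * Suc i - 2, 3 * Suc i - 1, 3 * Suc i, 3 * Suc i + 1}) ` {..<length es}"
      by (simp only: linear_path4_def snd_conv image_image)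
    also have "\<dots> = (\<lambda>i. es ! i) ` {..<length es}"
    proof (intro image_cong refl)
      fix i assume "i \<in> {..<length es}"
      moreover have "{3 * Suc i - 2, 3 * Suc i - 1, 3 * Suc i, 3 * Suc i + 1} =
          {3 * i + 1, 3 * i + 2, 3 * i + 3, 3 * i + 4}" by auto
      ultimately show "x ` {3 * Suc i - 2, 3 * Suc i - 1, 3 * Suc i, 3 * Suc i + 1} = es ! i"
        using x(3) by simp
    qed
    also have "\<dots> = set es" by (auto simp: set_conv_nth)
    finally show ?thesis ..
  qed
  then have "isomorphic (linear_path4 (length es)) ?K"
    unfolding isomorphic_def using x(1,2)
    by (intro exI[of _ x]) (auto simp: bij_betw_def linear_path4_def)
  ultimately show ?thesis by (auto simp: is_free_def)
qed

text \<open>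
  By the density lemma some vertex set \<open>X\<close> meets few edges. Deleting them frees the vertices in
  \<open>X\<close>, which pay for the deleted edges.
\<close>
lemma card_edges_le_if_no_loose_path:
  assumes "linear_quadruples E"
    and "\<And>es. loose_path es \<Longrightarrow> set es \<subseteq> E \<Longrightarrow> length es \<noteq> k"
  shows "2 * card E \<le> 5 * k * card (\<Union> E)"
  using assms
proof (induction "card E" arbitrary: E rule: less_induct)
  case less
  interpret linear_quadruples E by fact
  show ?case
  proof (cases "E = {}")
    case False
    then obtain X where X: "X \<subseteq> \<Union> E" "X \<noteq> {}"
      "2 * card {e \<in> E. \<not> disjnt e X} \<le> 5 * k * card X"
      using exists_loose_path_if_dense[of k] less.prems(2) by (meson not_less)
    define E' where "E' = {e \<in> E. disjnt e X}"
    define M where "M = {e \<in> E. \<not> disjnt e X}"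
    have EM: "E = E' \<union> M" "E' \<inter> M = {}" by (auto simp: E'_def M_def)
    have fin: "finite E'" "finite M" using finite_edges by (auto simp: E'_def M_def)
    have card: "card E = card E' + card M"
      using card_Un_disjoint[OF fin EM(2)] EM(1) by simp
    have "M \<noteq> {}" using X(1,2) by (auto simp: M_def disjnt_iff)
    then have "card E' < card E" using card fin by (simp add: card_gt_0_iff)
    moreover have "linear_quadruples E'"
      using finite_edges card_edge linear by unfold_locales (auto simp: E'_def)
    ultimately have IH: "2 * card E' \<le> 5 * k * card (\<Union> E')"
      using less.prems(2) EM(1) by (intro less.hyps) auto
    have finU: "finite (\<Union> E)" using finite_edges finite_edge by auto
    have "card (\<Union> E') \<le> card (\<Union> E - X)"
      using finU by (intro card_mono) (auto simp: E'_def disjnt_iff)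
    also have "\<dots> = card (\<Union> E) - card X"
      using X(1) finU finite_subset by (intro card_Diff_subset) auto
    finally have "card (\<Union> E') + card X \<le> card (\<Union> E)"
      using card_mono[OF finU X(1)] by simp
    then have "5 * k * (card (\<Union> E') + card X) \<le> 5 * k * card (\<Union> E)" by (rule mult_le_mono2)
    then show ?thesis using IH X(3) card unfolding M_def[symmetric] add_mult_distrib2 by simp
  qed simp
qed

theorem theorem1p3:
  fixes n k :: nat
  assumes "n \<ge> 1" and "k \<ge> 1"
  shows "real (ex_lin4 n (linear_path4 k)) \<le> 2.5 * real k * real n"
proof -
  have "edges (linear_path4 k) \<noteq> {}" using assms(2) by (simp add: linear_path4_def)
  then have "ex_lin4 n (linear_path4 k) \<in> edge_counts n (linear_path4 k)"
    unfolding ex_lin4_def by (intro Max_in finite_edge_counts edge_counts_nonempty)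
  then obtain H :: "nat hypergraph" where H: "quadruple_system H" "linear_hypergraph H"
    "card (verts H) = n" "is_free (linear_path4 k) H"
    and ex: "ex_lin4 n (linear_path4 k) = card (edges H)"
    by (auto simp: edge_counts_def)
  have sub: "\<Union> (edges H) \<subseteq> verts H" and fin: "finite (verts H)"
    using H(1) by (auto simp: quadruple_system_def)
  have lin: "linear_quadruples (edges H)"
  proof
    have "edges H \<subseteq> Pow (verts H)" using sub by auto
    then show "finite (edges H)" using fin by (meson finite_Pow_iff finite_subset)
    show "card e = 4" if "e \<in> edges H" for e
      using H(1) that by (simp add: quadruple_system_def)
    show "e = f" if "e \<in> edges H" "f \<in> edges H" "x \<in> e" "y \<in> e" "x \<in> f" "y \<in> f" "x \<noteq> y"
      for e f x y
    proof -
      have "x \<in> verts H" "y \<in> verts H" using that sub by auto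
      then show ?thesis using H(2) that unfolding linear_hypergraph_def by blast
    qed
  qed
  have "length es \<noteq> k" if "loose_path es" "set es \<subseteq> edges H" for es
  proof
    assume "length es = k"
    moreover from this have "es \<noteq> []" using assms(2) by auto
    ultimately show False using loose_path_not_free[OF lin sub that] H(4) by simp
  qed
  then have "2 * card (edges H) \<le> 5 * k * card (\<Union> (edges H))"
    by (rule card_edges_le_if_no_loose_path[OF lin])
  also have "\<dots> \<le> 5 * k * n"
    using card_mono[OF fin sub] H(3) by simp
  finally have "real (2 * card (edges H)) \<le> real (5 * k * n)" by (rule of_nat_mono)
  then show ?thesis by (simp add: ex)
qed

end
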